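(* The rank sum oracle (Sum) is not polynomially reducible to any of the following: the minimum rank oracle (Min), the common independence oracle (CI), the maximum rank oracle (Max), and the combined oracle CI+Max.
   Context: Let $\mathbf{M}_1=(E,\mathcal{I}_1)$, $\mathbf{M}_2=(E,\mathcal{I}_2)$ be loopless matroids on a common finite ground set $E$ with rank functions $r_1,r_2$. For a queried $X\subseteq E$: Sum returns $r_1(X)+r_2(X)$; Min returns $\min\{r_1(X),r_2(X)\}$; Max returns $\max\{r_1(X),r_2(X)\}$; CI returns ``Yes'' if $X\in\mathcal{I}_1\cap\mathcal{I}_2$ and ``No'' otherwise; CI+Max returns both the CI answer and the Max answer for $X$. An oracle $\mathcal{O}_1$ is polynomially reducible to an oracle $\mathcal{O}_2$ if, for every such pair of matroids, the answer of $\mathcal{O}_1$ to any query can be computed using a number of calls to $\mathcal{O}_2$ bounded by a polynomial in $|E|$ (in particular, the answers of $\mathcal{O}_2$ must determine those of $\mathcal{O}_1$). *)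

theory Defs
  imports Main "HOL-Computational_Algebra.Polynomial"
begin

locale matroid =
  fixes E :: "'a set" and \<I> :: "'a set set"
  assumes finite_ground: "finite E"
    and indep_subset_ground: "X \<in> \<I> \<Longrightarrow> X \<subseteq> E"
    and indep_empty: "{} \<in> \<I>"
    and indep_hereditary: "Y \<in> \<I> \<Longrightarrow> X \<subseteq> Y \<Longrightarrow> X \<in> \<I>"
    and indep_augment:
      "X \<in> \<I> \<Longrightarrow> Y \<in> \<I> \<Longrightarrow> card X < card Y \<Longrightarrow> \<exists>y\<in>Y - X. insert y X \<in> \<I>"

locale loopless_matroid = matroid +
  assumes loopless: "e \<in> E \<Longrightarrow> {e} \<in> \<I>"

definition rank :: "'a set set \<Rightarrow> 'a set \<Rightarrow> nat" where
  "rank \<I> X = Max {card Y | Y. Y \<in> \<I> \<and> Y \<subseteq> X}"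

text \<open>A \<open>matroid_oracle\<close> maps a pair of matroids (given by their independent sets) and a queried set
  to an answer of type \<open>'b\<close>.\<close>

type_synonym ('a, 'b) matroid_oracle = "'a set set \<Rightarrow> 'a set set \<Rightarrow> 'a set \<Rightarrow> 'b"

definition Sum_oracle :: "('a, nat) matroid_oracle" where
  "Sum_oracle \<I>\<^sub>1 \<I>\<^sub>2 X = rank \<I>\<^sub>1 X + rank \<I>\<^sub>2 X"

definition Min_oracle :: "('a, nat) matroid_oracle" where
  "Min_oracle \<I>\<^sub>1 \<I>\<^sub>2 X = min (rank \<I>\<^sub>1 X) (rank \<I>\<^sub>2 X)"

definition Max_oracle :: "('a, nat) matroid_oracle" where
  "Max_oracle \<I>\<^sub>1 \<I>\<^sub>2 X = max (rank \<I>\<^sub>1 X) (rank \<I>\<^sub>2 X)"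

definition CI_oracle :: "('a, bool) matroid_oracle" where
  "CI_oracle \<I>\<^sub>1 \<I>\<^sub>2 X \<longleftrightarrow> X \<in> \<I>\<^sub>1 \<inter> \<I>\<^sub>2"

definition CI_Max_oracle :: "('a, bool \<times> nat) matroid_oracle" where
  "CI_Max_oracle \<I>\<^sub>1 \<I>\<^sub>2 X = (CI_oracle \<I>\<^sub>1 \<I>\<^sub>2 X, Max_oracle \<I>\<^sub>1 \<I>\<^sub>2 X)"

text \<open>Deterministic adaptive query algorithms: either output a result, or query a set and
  continue depending on the answer. Only the queries are counted.\<close>

datatype ('a, 'b, 'c) query_alg =
    Output 'c
  | Query "'a set" "'b \<Rightarrow> ('a, 'b, 'c) query_alg"

primrec result :: "('a set \<Rightarrow> 'b) \<Rightarrow> ('a, 'b, 'c) query_alg \<Rightarrow> 'c" where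
  "result q (Output c) = c"
| "result q (Query X k) = result q (k (q X))"

primrec queries :: "('a set \<Rightarrow> 'b) \<Rightarrow> ('a, 'b, 'c) query_alg \<Rightarrow> 'a set list" where
  "queries q (Output c) = []"
| "queries q (Query X k) = X # queries q (k (q X))"

text \<open>The algorithm \<open>A E X\<close> knows the ground set and the query to be answered, and has access
  to the two matroids only through \<open>\<O>\<^sub>2\<close>. The definition is meant to be used with an
  infinite type \<open>'a\<close>, so that ground sets of every finite size occur.\<close>

definition poly_reducible :: "('a, 'c) matroid_oracle \<Rightarrow> ('a, 'b) matroid_oracle \<Rightarrow> bool" where
  "poly_reducible \<O>\<^sub>1 \<O>\<^sub>2 \<longleftrightarrow>
    (\<exists>(A :: 'a set \<Rightarrow> 'a set \<Rightarrow> ('a, 'b, 'c) query_alg) (p :: nat poly).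
      \<forall>E \<I>\<^sub>1 \<I>\<^sub>2 X. loopless_matroid E \<I>\<^sub>1 \<longrightarrow> loopless_matroid E \<I>\<^sub>2 \<longrightarrow> X \<subseteq> E \<longrightarrow>
        result (\<O>\<^sub>2 \<I>\<^sub>1 \<I>\<^sub>2) (A E X) = \<O>\<^sub>1 \<I>\<^sub>1 \<I>\<^sub>2 X \<and>
        set (queries (\<O>\<^sub>2 \<I>\<^sub>1 \<I>\<^sub>2) (A E X)) \<subseteq> Pow E \<and>
        length (queries (\<O>\<^sub>2 \<I>\<^sub>1 \<I>\<^sub>2) (A E X)) \<le> poly p (card E))"

end

theory Submission
  imports Defs
begin

text \<open>
  None of the four oracles determines Sum, so the number of queries is irrelevant.
  On \<open>{0, 1, 2, 3}\<close>, let \<open>U\<close> be the uniform matroid of rank 3, and let \<open>P\<close>, \<open>Q\<close>, \<open>R\<close> be the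
  partition matroids whose only dependent pairs are \<open>{0, 1}\<close> and \<open>{2, 3}\<close> for \<open>P\<close>, \<open>{0, 1}\<close> for \<open>Q\<close>, and
  \<open>{2, 3}\<close> for \<open>R\<close>, with ranks 2, 3 and 3.
  Since Max depends only on the union of the two families of independent sets and CI only on their
  intersection, and \<open>U \<union> P = Q \<union> R\<close> and \<open>U \<inter> P = Q \<inter> R\<close>, the pairs \<open>(U, P)\<close> and \<open>(Q, R)\<close> are
  indistinguishable for CI+Max, but their rank sums are 5 and 6.
  For Min, \<open>P \<subseteq> U\<close> makes \<open>(P, P)\<close> and \<open>(U, P)\<close> indistinguishable, with rank sums 4 and 5.
\<close>

text \<open>\<open>A E X\<close> is one query tree for both pairs, and its result depends only on
  the answers of \<open>\<O>\<^sub>2\<close>; equal answers would force equal values of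
  \<open>\<O>\<^sub>1\<close> at \<open>X\<close>.\<close>

lemma not_poly_reducible_if_indistinguishable:
  assumes "loopless_matroid E \<I>\<^sub>1" "loopless_matroid E \<I>\<^sub>2"
    and "loopless_matroid E \<J>\<^sub>1" "loopless_matroid E \<J>\<^sub>2"
    and "X \<subseteq> E" and same: "\<O>\<^sub>2 \<I>\<^sub>1 \<I>\<^sub>2 = \<O>\<^sub>2 \<J>\<^sub>1 \<J>\<^sub>2"
    and diff: "\<O>\<^sub>1 \<I>\<^sub>1 \<I>\<^sub>2 X \<noteq> \<O>\<^sub>1 \<J>\<^sub>1 \<J>\<^sub>2 X"
  shows "\<not> poly_reducible \<O>\<^sub>1 \<O>\<^sub>2"
proof
  assume "poly_reducible \<O>\<^sub>1 \<O>\<^sub>2"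
  then obtain A p where A: "\<forall>E \<I>\<^sub>1 \<I>\<^sub>2 X. loopless_matroid E \<I>\<^sub>1 \<longrightarrow> loopless_matroid E \<I>\<^sub>2 \<longrightarrow> X \<subseteq> E \<longrightarrow>
      result (\<O>\<^sub>2 \<I>\<^sub>1 \<I>\<^sub>2) (A E X) = \<O>\<^sub>1 \<I>\<^sub>1 \<I>\<^sub>2 X \<and>
      set (queries (\<O>\<^sub>2 \<I>\<^sub>1 \<I>\<^sub>2) (A E X)) \<subseteq> Pow E \<and>
      length (queries (\<O>\<^sub>2 \<I>\<^sub>1 \<I>\<^sub>2) (A E X)) \<le> poly p (card E)"
    unfolding poly_reducible_def by (elim exE)
  have "result (\<O>\<^sub>2 \<I>\<^sub>1 \<I>\<^sub>2) (A E X) = \<O>\<^sub>1 \<I>\<^sub>1 \<I>\<^sub>2 X"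
    using A[rule_format, OF assms(1,2,5)] by (rule conjunct1)
  moreover have "result (\<O>\<^sub>2 \<J>\<^sub>1 \<J>\<^sub>2) (A E X) = \<O>\<^sub>1 \<J>\<^sub>1 \<J>\<^sub>2 X"
    using A[rule_format, OF assms(3,4,5)] by (rule conjunct1)
  ultimately show False using same diff by simp
qed

lemma matroid_finite_indep: "matroid E \<I> \<Longrightarrow> finite \<I>"
  by (rule finite_subset[of _ "Pow E"]) (auto simp: matroid_def)

text \<open>\<open>rank\<close> makes sense for any set family, so the union need not be a matroid.
  The empty set keeps both maxima over nonempty sets.\<close>

lemma rank_Un:
  assumes "finite \<I>" "finite \<J>" "{} \<in> \<I>" "{} \<in> \<J>"
  shows "rank (\<I> \<union> \<J>) X = max (rank \<I> X) (rank \<J> X)"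
proof -
  have "{card Y | Y. Y \<in> \<I> \<union> \<J> \<and> Y \<subseteq> X}
      = {card Y | Y. Y \<in> \<I> \<and> Y \<subseteq> X} \<union> {card Y | Y. Y \<in> \<J> \<and> Y \<subseteq> X}"
    by blast
  then show ?thesis
    unfolding rank_def using assms by (simp only:) (subst Max_Un, auto)
qed

lemma Max_oracle_eq_rank_Un:
  assumes "matroid E \<I>" "matroid E \<J>"
  shows "Max_oracle \<I> \<J> = rank (\<I> \<union> \<J>)"
proof -
  have "finite \<I>" "finite \<J>" "{} \<in> \<I>" "{} \<in> \<J>"
    using assms matroid_finite_indep matroid.indep_empty by blast+
  then show ?thesis
    by (simp add: fun_eq_iff Max_oracle_def rank_Un)
qed

lemma Min_oracle_absorb:
  assumes "matroid E \<I>" "matroid E \<J>" "\<J> \<subseteq> \<I>"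
  shows "Min_oracle \<I> \<J> = rank \<J>"
proof -
  have "rank \<J> X \<le> rank \<I> X" for X
  proof -
    \<comment> \<open>Monotonicity of \<open>rank\<close> in the family is read off from the union
      formula: adding \<open>\<J>\<close> to \<open>\<I>\<close> changes nothing.\<close>
    have "max (rank \<I> X) (rank \<J> X) = rank (\<I> \<union> \<J>) X"
      using Max_oracle_eq_rank_Un[OF assms(1,2)] by (metis Max_oracle_def)
    also have "\<I> \<union> \<J> = \<I>" using assms(3) by blast
    finally show ?thesis by linarith
  qed
  then show ?thesis by (intro ext) (simp add: Min_oracle_def)
qed

lemma CI_Max_oracle_cong:
  assumes "matroid E \<I>\<^sub>1" "matroid E \<I>\<^sub>2" "matroid E \<J>\<^sub>1" "matroid E \<J>\<^sub>2"
    and "\<I>\<^sub>1 \<union> \<I>\<^sub>2 = \<J>\<^sub>1 \<union> \<J>\<^sub>2" "\<I>\<^sub>1 \<inter> \<I>\<^sub>2 = \<J>\<^sub>1 \<inter> \<J>\<^sub>2"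
  shows "CI_Max_oracle \<I>\<^sub>1 \<I>\<^sub>2 = CI_Max_oracle \<J>\<^sub>1 \<J>\<^sub>2"
  unfolding CI_Max_oracle_def CI_oracle_def Max_oracle_eq_rank_Un[OF assms(1,2)]
    Max_oracle_eq_rank_Un[OF assms(3,4)] assms(5,6) ..

definition uniform_indep :: "'a set \<Rightarrow> nat \<Rightarrow> 'a set set" where
  "uniform_indep E k = {X. X \<subseteq> E \<and> card X \<le> k}"

definition partition_indep :: "'a set \<Rightarrow> ('a \<Rightarrow> 'b) \<Rightarrow> 'a set set" where
  "partition_indep E f = {X. X \<subseteq> E \<and> inj_on f X}"

text \<open>Describes independence by forbidden pairs, which can be enumerated on a concrete ground
  set.\<close>

lemma in_partition_indep_iff:
  "X \<in> partition_indep E f \<longleftrightarrow>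
    X \<subseteq> E \<and> (\<forall>x\<in>E. \<forall>y\<in>E. f x = f y \<longrightarrow> x \<noteq> y \<longrightarrow> \<not> {x, y} \<subseteq> X)"
  unfolding partition_indep_def inj_on_def by blast

lemma loopless_matroid_uniform:
  assumes "finite E" "k > 0"
  shows "loopless_matroid E (uniform_indep E k)"
proof
  fix X Y assume X: "X \<in> uniform_indep E k" and Y: "Y \<in> uniform_indep E k" and lt: "card X < card Y"
  have "finite X" using X assms finite_subset by (auto simp: uniform_indep_def)
  then obtain y where "y \<in> Y - X"
    using lt card_mono[of X Y] by (metis Diff_iff leD subsetI)
  with X Y lt \<open>finite X\<close> show "\<exists>y\<in>Y - X. insert y X \<in> uniform_indep E k"
    by (intro bexI[of _ y]) (auto simp: uniform_indep_def)
next
  fix X Y assume Y: "Y \<in> uniform_indep E k" "X \<subseteq> Y"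
  then have "card X \<le> card Y"
    using assms by (intro card_mono) (auto simp: uniform_indep_def intro: finite_subset)
  with Y show "X \<in> uniform_indep E k" by (auto simp: uniform_indep_def)
qed (use assms in \<open>auto simp: uniform_indep_def\<close>)

lemma loopless_matroid_partition:
  assumes "finite E"
  shows "loopless_matroid E (partition_indep E f)"
proof
  fix X Y assume X: "X \<in> partition_indep E f" and Y: "Y \<in> partition_indep E f"
    and lt: "card X < card Y"
  have "finite X" using X assms finite_subset by (auto simp: partition_indep_def)
  moreover have "card (f ` X) < card (f ` Y)"
    using X Y lt by (simp add: partition_indep_def card_image)
  \<comment> \<open>Since \<open>f\<close> is injective on both sets, \<open>Y\<close> meets more
    classes than \<open>X\<close>; an element of a class missed by \<open>X\<close> can be
    added.\<close>
  ultimately obtain y where "y \<in> Y" "f y \<notin> f ` X"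
    by (metis card_mono finite_imageI image_subsetI leD)
  with X Y show "\<exists>y\<in>Y - X. insert y X \<in> partition_indep E f"
    by (intro bexI[of _ y]) (auto simp: partition_indep_def)
qed (use assms in \<open>auto simp: partition_indep_def intro: inj_on_subset\<close>)

lemma rank_uniform:
  assumes "finite E" "X \<subseteq> E"
  shows "rank (uniform_indep E k) X = min k (card X)"
proof -
  have fin: "finite X" using assms finite_subset by blast
  obtain Z where "Z \<subseteq> X" "card Z = min k (card X)"
    using obtain_subset_with_card_n[of "min k (card X)" X] by auto
  moreover have "card Y \<le> card X" if "Y \<subseteq> X" for Y
    using that fin by (rule card_mono[rotated])
  ultimately show ?thesis
    unfolding rank_def using assms fin
    by (intro Max_eqI) (auto simp: uniform_indep_def intro!: exI[of _ Z])
qed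

lemma rank_partition:
  assumes "finite E" "X \<subseteq> E"
  shows "rank (partition_indep E f) X = card (f ` X)"
proof -
  have fin: "finite X" using assms finite_subset by blast
  \<comment> \<open>\<open>Z\<close> picks one representative of each class met by \<open>X\<close>,
    so it attains the upper bound.\<close>
  obtain Z where Z: "Z \<subseteq> X" "inj_on f Z" "f ` Z = f ` X"
    using subset_image_inj[of "f ` X" f X] by auto
  have le: "card Y \<le> card (f ` X)" if "Y \<subseteq> X" "inj_on f Y" for Y
    using that fin by (metis card_image card_mono finite_imageI image_mono)
  moreover have "card Z = card (f ` X)"
    using Z by (metis card_image)
  moreover have "finite {card Y | Y. Y \<in> partition_indep E f \<and> Y \<subseteq> X}"
    by (rule finite_subset[of _ "{..card (f ` X)}"]) (auto simp: partition_indep_def le)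
  ultimately show ?thesis
    unfolding rank_def using assms Z
    by (intro Max_eqI) (auto simp: partition_indep_def intro!: exI[of _ Z])
qed

abbreviation ground :: "nat set" where
  "ground \<equiv> {0, 1, 2, 3}"

definition U :: "nat set set" where
  "U = uniform_indep ground 3"

text \<open>On \<open>ground\<close>, \<open>x div 2\<close> has the classes \<open>{0, 1}\<close>
  and \<open>{2, 3}\<close>; in \<open>Q\<close> and \<open>R\<close> below, \<open>max 1\<close>
  merges only 0 with 1, and \<open>min 2\<close> only 2 with 3.\<close>

definition P :: "nat set set" where
  "P = partition_indep ground (\<lambda>x. x div 2)"

definition Q :: "nat set set" where
  "Q = partition_indep ground (max 1)"

definition R :: "nat set set" where
  "R = partition_indep ground (min 2)"

lemma loopless_matroid_UPQR:
  "loopless_matroid ground U" "loopless_matroid ground P"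
  "loopless_matroid ground Q" "loopless_matroid ground R"
  by (simp_all add: U_def P_def Q_def R_def loopless_matroid_uniform loopless_matroid_partition)

lemmas matroid_UPQR = loopless_matroid_UPQR[THEN loopless_matroid.axioms(1)]

lemma rank_UPQR:
  "rank U ground = 3" "rank P ground = 2" "rank Q ground = 3" "rank R ground = 3"
  by (simp_all add: U_def P_def Q_def R_def rank_uniform rank_partition)

text \<open>With four elements in all, only \<open>ground\<close> itself has more than three.
  Together with the next three lemmas, this reduces identities between the families to propositional
  reasoning about which pairs a set contains.\<close>

lemma in_U_iff: "X \<in> U \<longleftrightarrow> X \<subseteq> ground \<and> X \<noteq> ground"
proof -
  have "card X \<le> 3 \<longleftrightarrow> X \<noteq> ground" if "X \<subseteq> ground"
  proof
    assume "X \<noteq> ground"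
    with that have "card X < card ground" by (intro psubset_card_mono psubsetI) simp_all
    then show "card X \<le> 3" by simp
  next
    assume "card X \<le> 3"
    then show "X \<noteq> ground" by (intro notI) simp
  qed
  then show ?thesis
    by (simp only: U_def uniform_indep_def mem_Collect_eq cong: conj_cong)
qed

lemma in_P_iff: "X \<in> P \<longleftrightarrow> X \<subseteq> ground \<and> \<not> {0, 1} \<subseteq> X \<and> \<not> {2, 3} \<subseteq> X"
proof -
  have "(\<forall>x\<in>ground. \<forall>y\<in>ground. x div 2 = y div 2 \<longrightarrow> x \<noteq> y \<longrightarrow> \<not> {x, y} \<subseteq> X)
      \<longleftrightarrow> \<not> {0, 1} \<subseteq> X \<and> \<not> {2, 3} \<subseteq> X"
    by auto
  then show ?thesis by (simp only: P_def in_partition_indep_iff)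
qed

lemma in_Q_iff: "X \<in> Q \<longleftrightarrow> X \<subseteq> ground \<and> \<not> {0, 1} \<subseteq> X"
proof -
  have "(\<forall>x\<in>ground. \<forall>y\<in>ground. max 1 x = max 1 y \<longrightarrow> x \<noteq> y \<longrightarrow> \<not> {x, y} \<subseteq> X)
      \<longleftrightarrow> \<not> {0, 1} \<subseteq> X"
    by auto
  then show ?thesis by (simp only: Q_def in_partition_indep_iff)
qed

lemma in_R_iff: "X \<in> R \<longleftrightarrow> X \<subseteq> ground \<and> \<not> {2, 3} \<subseteq> X"
proof -
  have "(\<forall>x\<in>ground. \<forall>y\<in>ground. min 2 x = min 2 y \<longrightarrow> x \<noteq> y \<longrightarrow> \<not> {x, y} \<subseteq> X)
      \<longleftrightarrow> \<not> {2, 3} \<subseteq> X"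
    by auto
  then show ?thesis by (simp only: R_def in_partition_indep_iff)
qed

lemma CI_Max_oracle_UP_eq_QR: "CI_Max_oracle U P = CI_Max_oracle Q R"
proof (rule CI_Max_oracle_cong[OF matroid_UPQR])
  show "U \<union> P = Q \<union> R"
    \<comment> \<open>A subset of \<open>ground\<close> differs from \<open>ground\<close> exactly
      when it fails to contain one of the two pairs.\<close>
    by (rule set_eqI) (unfold Un_iff in_U_iff in_P_iff in_Q_iff in_R_iff, blast)
  show "U \<inter> P = Q \<inter> R"
    by (rule set_eqI) (unfold Int_iff in_U_iff in_P_iff in_Q_iff in_R_iff, blast)
qed

lemma Min_oracle_PP_eq_UP: "Min_oracle P P = Min_oracle U P"
proof -
  have "P \<subseteq> U"
    by (rule subsetI) (unfold in_U_iff in_P_iff, blast)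
  then show ?thesis
    using Min_oracle_absorb matroid_UPQR by (metis order_refl)
qed

theorem theorem3p3:
  shows "\<not> poly_reducible (Sum_oracle :: (nat, nat) matroid_oracle) Min_oracle
    \<and> \<not> poly_reducible (Sum_oracle :: (nat, nat) matroid_oracle) CI_oracle
    \<and> \<not> poly_reducible (Sum_oracle :: (nat, nat) matroid_oracle) Max_oracle
    \<and> \<not> poly_reducible (Sum_oracle :: (nat, nat) matroid_oracle) CI_Max_oracle"
proof -
  have eqs: "CI_oracle U P = CI_oracle Q R" "Max_oracle U P = Max_oracle Q R"
    using CI_Max_oracle_UP_eq_QR by (simp_all add: fun_eq_iff CI_Max_oracle_def)
  have Sum_PP_UP: "Sum_oracle P P ground \<noteq> Sum_oracle U P ground"
    and Sum_UP_QR: "Sum_oracle U P ground \<noteq> Sum_oracle Q R ground"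
    unfolding Sum_oracle_def rank_UPQR by simp_all
  note Min = not_poly_reducible_if_indistinguishable
    [where \<O>\<^sub>1 = Sum_oracle, OF loopless_matroid_UPQR(2,2,1,2) order_refl _ Sum_PP_UP]
  \<comment> \<open>\<open>\<O>\<^sub>2\<close> stays open, so this one instance serves CI, Max and
    CI+Max.\<close>
  note CI_Max = not_poly_reducible_if_indistinguishable
    [where \<O>\<^sub>1 = Sum_oracle, OF loopless_matroid_UPQR order_refl _ Sum_UP_QR]
  show ?thesis
    using Min[of Min_oracle, OF Min_oracle_PP_eq_UP] CI_Max[of CI_oracle, OF eqs(1)]
      CI_Max[of Max_oracle, OF eqs(2)] CI_Max[of CI_Max_oracle, OF CI_Max_oracle_UP_eq_QR]
    by (intro conjI)
qed

end
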